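(* Let $\mu,\nu>0$, let $n\ge0$ be an integer, and let $x\in\mathbb{R}$, $\xi\in\mathbb{R}\setminus\{0\}$, $z\in\mathbb{C}$. Then $$\sum_{m=0}^{+\infty}\frac{\xi^m\,H_m^\mu(x)\,\overline{H_{m,n}^{\nu}(z,\overline{z})}}{m!\,\nu^m}=e^{-\mu\left(\xi^2\overline{z}^2-2x\xi\overline{z}\right)}\,H_n^{\mu\xi^2}\left(\overline{z}+\frac{\nu}{2\mu\xi^2}z-\frac{x}{\xi}\right).$$
   Context: For $\mu>0$, the rescaled real Hermite polynomials are $$H_n^\mu(x):=(-1)^n e^{\mu x^2}\frac{d^n}{dx^n}\left(e^{-\mu x^2}\right),$$ extended as polynomials to complex arguments. The univariate complex Hermite polynomials are, for integers $m,n\ge0$, $$H_{m,n}^\nu(z,\overline{z})=(-1)^{m+n}e^{\nu z\overline{z}}\frac{\partial^{m+n}}{\partial \overline{z}^{m}\partial z^{n}}\left(e^{-\nu z\overline{z}}\right),$$ where $\partial/\partial z$ and $\partial/\partial\overline{z}$ are the Wirtinger derivatives. *)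

theory Defs
  imports "HOL-Analysis.Analysis" "HOL-Computational_Algebra.Polynomial"
begin

definition hermite :: "real \<Rightarrow> nat \<Rightarrow> real \<Rightarrow> real" where
  "hermite \<mu> n x =
     (-1) ^ n * exp (\<mu> * x\<^sup>2) * (deriv ^^ n) (\<lambda>t. exp (- \<mu> * t\<^sup>2)) x"

text \<open>
  The function \<^term>\<open>hermite \<mu> n\<close> is a polynomial function on the reals; see
  \<open>hermite_poly_ex1\<close> below for the existence and uniqueness of the polynomial.
\<close>

definition hermite_poly :: "real \<Rightarrow> nat \<Rightarrow> real poly" where
  "hermite_poly \<mu> n = (THE p. \<forall>x. poly p x = hermite \<mu> n x)"

definition hermite_complex :: "real \<Rightarrow> nat \<Rightarrow> complex \<Rightarrow> complex" where
  "hermite_complex \<mu> n w = poly (map_poly complex_of_real (hermite_poly \<mu> n)) w"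

lemma deriv_gaussian_poly:
  "\<exists>p. (deriv ^^ n) (\<lambda>t::real. exp (- \<mu> * t\<^sup>2)) = (\<lambda>t. poly p t * exp (- \<mu> * t\<^sup>2))"
proof (induction n)
  case 0
  show ?case by (rule exI[of _ 1]) simp
next
  case (Suc n)
  then obtain p where p:
    "(deriv ^^ n) (\<lambda>t::real. exp (- \<mu> * t\<^sup>2)) = (\<lambda>t. poly p t * exp (- \<mu> * t\<^sup>2))" by blast
  have "((\<lambda>t. poly p t * exp (- \<mu> * t\<^sup>2)) has_field_derivative
      poly (pderiv p - [:0, 2 * \<mu>:] * p) t * exp (- \<mu> * t\<^sup>2)) (at t)" for t
    by (rule derivative_eq_intros poly_DERIV refl | simp add: algebra_simps)+
  then have "deriv (\<lambda>t. poly p t * exp (- \<mu> * t\<^sup>2)) =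
      (\<lambda>t. poly (pderiv p - [:0, 2 * \<mu>:] * p) t * exp (- \<mu> * t\<^sup>2))"
    by (intro ext DERIV_imp_deriv)
  with p show ?case
    by (intro exI[of _ "pderiv p - [:0, 2 * \<mu>:] * p"]) simp
qed

lemma hermite_poly_ex1: "\<exists>!p. \<forall>x. poly p x = hermite \<mu> n x"
proof -
  obtain p where p:
    "(deriv ^^ n) (\<lambda>t::real. exp (- \<mu> * t\<^sup>2)) = (\<lambda>t. poly p t * exp (- \<mu> * t\<^sup>2))"
    using deriv_gaussian_poly by blast
  have "poly (smult ((-1) ^ n) p) x = hermite \<mu> n x" for x
    unfolding hermite_def p by (simp add: exp_minus)
  then show ?thesis
    by (metis poly_eq_poly_eq_iff ext)
qed

lemma poly_hermite_poly: "poly (hermite_poly \<mu> n) x = hermite \<mu> n x"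
  using theI'[OF hermite_poly_ex1[of \<mu> n]] by (simp add: hermite_poly_def)

lemma hermite_complex_of_real:
  "hermite_complex \<mu> n (complex_of_real x) = complex_of_real (hermite \<mu> n x)"
proof -
  have "poly (map_poly complex_of_real p) (complex_of_real x) = complex_of_real (poly p x)" for p
    by (induction p) (simp_all add: map_poly_pCons)
  then show ?thesis
    by (simp add: hermite_complex_def poly_hermite_poly)
qed

definition partial_Re :: "(complex \<Rightarrow> complex) \<Rightarrow> complex \<Rightarrow> complex" where
  "partial_Re f z = vector_derivative (\<lambda>t::real. f (z + complex_of_real t)) (at 0)"

definition partial_Im :: "(complex \<Rightarrow> complex) \<Rightarrow> complex \<Rightarrow> complex" where
  "partial_Im f z = vector_derivative (\<lambda>t::real. f (z + \<i> * complex_of_real t)) (at 0)"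

definition wirtinger :: "(complex \<Rightarrow> complex) \<Rightarrow> complex \<Rightarrow> complex" where
  "wirtinger f z = (partial_Re f z - \<i> * partial_Im f z) / 2"

definition wirtinger_cnj :: "(complex \<Rightarrow> complex) \<Rightarrow> complex \<Rightarrow> complex" where
  "wirtinger_cnj f z = (partial_Re f z + \<i> * partial_Im f z) / 2"

text \<open>
  The polynomial \<open>H\<^sub>m\<^sub>,\<^sub>n(z, cnj z)\<close> is viewed as a function of \<open>z\<close> alone; \<open>m\<close> counts the
  derivatives in the conjugate variable and \<open>n\<close> those in \<open>z\<close>.
\<close>

definition hermite2 :: "real \<Rightarrow> nat \<Rightarrow> nat \<Rightarrow> complex \<Rightarrow> complex" where
  "hermite2 \<nu> m n z =
     (-1) ^ (m + n) * exp (complex_of_real \<nu> * z * cnj z) *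
     (wirtinger_cnj ^^ m) ((wirtinger ^^ n) (\<lambda>w. exp (- complex_of_real \<nu> * w * cnj w))) z"

end

theory Submission
  imports Defs "HOL-Complex_Analysis.Cauchy_Integral_Formula"
begin

text \<open>
  Write \<open>w = cnj z\<close>. Expanding the Wirtinger derivatives by the Leibniz rule gives
  \<open>H\<^sub>m\<^sub>,\<^sub>n\<close> as a finite sum over \<open>k \<le> n\<close> (lemma \<open>hermite2_explicit\<close>), in which \<open>m\<close> enters
  only through \<open>\<nu>\<close> to a power and the falling factorial \<open>m! / (m - k)!\<close> times
  \<open>z\<close> to the power \<open>m - k\<close>. After conjugation, the last two factors form the \<open>k\<close>-th derivative of the
  \<open>m\<close>-th power of \<open>w\<close>. So the sum over \<open>m\<close> of the \<open>k\<close>-th terms is, up to a factor independent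
  of \<open>m\<close>, the \<open>k\<close>-th derivative of the generating function
  \[ G(w) = \sum_m \xi^m H_m^\mu(x) w^m / m! = e^{-\mu(\xi^2 w^2 - 2 x \xi w)} . \]

  The function \<open>G\<close> is a Gaussian in \<open>x - \<xi> w\<close> up to a constant factor, so
  \[ G^{(k)}(w) = \xi^k H_k^\mu(x - \xi w) G(w) \]
  (lemma \<open>higher_deriv_hermite_gen\<close>). At \<open>w = 0\<close> this identifies the Taylor coefficients of
  \<open>G\<close> as those of the generating function, and since every \<open>G\<^sup>(\<^sup>k\<^sup>)\<close> is entire, its
  Taylor series converges for all \<open>w\<close> (lemma \<open>hermite_gen_sums\<close>).

  What remains is the finite identity
  \[ \sum_{k \le n} {n \choose k} (\nu z)^{n-k} (-\xi)^k H_k^\mu(x - \xi w)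
     = H_n^{\mu\xi^2}(w - x/\xi + \nu z / (2\mu\xi^2)) . \]
  Rescaling the parameter (lemma \<open>hermite_complex_scale\<close> with factor \<open>-\<xi>\<close>) turns
  \<open>(-\<xi>)\<^sup>k H\<^sub>k(x - \<xi> w)\<close> into the Hermite polynomial of parameter \<open>\<mu> \<xi>\<^sup>2\<close> at \<open>w - x / \<xi>\<close>, and
  the sum is then an instance of the addition formula \<open>hermite_complex_add\<close>.
\<close>

section \<open>Pascal's rule\<close>

text \<open>
  This is the induction step shared by every Leibniz-type expansion below: a derivation acting on
  the \<open>n\<close>-th expansion raises either the first or the second index of each term, and the result
  is the \<open>(n+1)\<close>-st expansion.
\<close>
lemma sum_binomial_Suc:
  fixes f :: "nat \<Rightarrow> nat \<Rightarrow> 'a::comm_semiring_1"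
  shows "(\<Sum>k\<le>Suc n. of_nat (Suc n choose k) * f k (Suc n - k)) =
    (\<Sum>k\<le>n. of_nat (n choose k) * (f (Suc k) (n - k) + f k (Suc (n - k))))"
proof -
  have "(\<Sum>k\<le>Suc n. of_nat (Suc n choose k) * f k (Suc n - k)) =
      f 0 (Suc n) + (\<Sum>k\<le>n. of_nat (n choose k) * f (Suc k) (n - k))
        + (\<Sum>k\<le>n. of_nat (n choose Suc k) * f (Suc k) (n - k))"
    by (simp only: sum.atMost_Suc_shift) (simp add: algebra_simps sum.distrib)
  also have "f 0 (Suc n) + (\<Sum>k\<le>n. of_nat (n choose k) * f (Suc k) (n - k))
        + (\<Sum>k\<le>n. of_nat (n choose Suc k) * f (Suc k) (n - k)) =
      (\<Sum>k\<le>n. of_nat (n choose k) * f (Suc k) (n - k))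
        + (\<Sum>k\<le>Suc n. of_nat (n choose k) * f k (Suc n - k))"
    by (simp only: sum.atMost_Suc_shift) (simp add: algebra_simps)
  also have "(\<Sum>k\<le>Suc n. of_nat (n choose k) * f k (Suc n - k)) =
      (\<Sum>k\<le>n. of_nat (n choose k) * f k (Suc (n - k)))"
    by (simp add: Suc_diff_le binomial_eq_0)
  finally show ?thesis
    by (simp add: sum.distrib algebra_simps)
qed

section \<open>Real Hermite polynomials\<close>

lemma hermite_poly_0: "hermite_poly \<mu> 0 = 1"
proof -
  have "poly (hermite_poly \<mu> 0) = poly 1"
    by (rule ext) (simp add: poly_hermite_poly hermite_def exp_minus)
  then show ?thesis by (simp only: poly_eq_poly_eq_iff)
qed

text \<open>
  The Rodrigues formula enters the rest of the argument only through this recursion and its start. It is an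
  identity of polynomials, so it transfers to complex arguments, where the Rodrigues formula
  itself, stated with real derivatives, says nothing.
\<close>
lemma hermite_poly_Suc:
  "hermite_poly \<mu> (Suc n) = [:0, 2 * \<mu>:] * hermite_poly \<mu> n - pderiv (hermite_poly \<mu> n)"
proof -
  have cancel: "(-1) ^ i * exp (\<mu> * t\<^sup>2) * ((-1) ^ i * (q * exp (- \<mu> * t\<^sup>2))) = q"
    for i and q t :: real
  proof -
    have "(-1) ^ i * exp (\<mu> * t\<^sup>2) * ((-1) ^ i * (q * exp (- \<mu> * t\<^sup>2))) =
        ((-1) ^ i * (-1) ^ i) * (exp (\<mu> * t\<^sup>2) * exp (- \<mu> * t\<^sup>2)) * q"
      by (simp only: mult_ac)
    then show ?thesis
      by (simp add: exp_minus flip: power_mult_distrib)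
  qed
  have gauss: "(deriv ^^ n) (\<lambda>t. exp (- \<mu> * t\<^sup>2)) =
      (\<lambda>t. (-1) ^ n * (poly (hermite_poly \<mu> n) t * exp (- \<mu> * t\<^sup>2)))"
    by (rule ext) (simp add: poly_hermite_poly hermite_def exp_minus field_simps
        flip: power_mult_distrib)
  have "((\<lambda>t. (-1) ^ n * (poly (hermite_poly \<mu> n) t * exp (- \<mu> * t\<^sup>2))) has_field_derivative
      (-1) ^ Suc n * (poly ([:0, 2 * \<mu>:] * hermite_poly \<mu> n - pderiv (hermite_poly \<mu> n)) t
        * exp (- \<mu> * t\<^sup>2))) (at t)" for t
    by (rule derivative_eq_intros poly_DERIV refl | simp add: algebra_simps)+
  then have "(deriv ^^ Suc n) (\<lambda>t. exp (- \<mu> * t\<^sup>2)) t =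
      (-1) ^ Suc n * (poly ([:0, 2 * \<mu>:] * hermite_poly \<mu> n - pderiv (hermite_poly \<mu> n)) t
        * exp (- \<mu> * t\<^sup>2))" for t
    by (simp only: funpow.simps comp_apply gauss DERIV_imp_deriv)
  then have "poly (hermite_poly \<mu> (Suc n)) t =
      poly ([:0, 2 * \<mu>:] * hermite_poly \<mu> n - pderiv (hermite_poly \<mu> n)) t" for t
    by (simp only: poly_hermite_poly[of _ "Suc n"] hermite_def[of _ "Suc n"] cancel)
  then show ?thesis
    by (metis ext poly_eq_poly_eq_iff)
qed

definition hermite_cpoly :: "real \<Rightarrow> nat \<Rightarrow> complex poly" where
  "hermite_cpoly \<mu> n = map_poly complex_of_real (hermite_poly \<mu> n)"

lemma hermite_complex_eq_poly: "hermite_complex \<mu> n = poly (hermite_cpoly \<mu> n)"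
  by (rule ext) (simp add: hermite_complex_def hermite_cpoly_def)

lemma hermite_cpoly_0: "hermite_cpoly \<mu> 0 = 1"
  by (simp add: hermite_cpoly_def hermite_poly_0)

lemma hermite_cpoly_Suc:
  "hermite_cpoly \<mu> (Suc n) =
    [:0, 2 * of_real \<mu>:] * hermite_cpoly \<mu> n - pderiv (hermite_cpoly \<mu> n)"
  unfolding hermite_cpoly_def hermite_poly_Suc
  by (rule poly_eqI) (auto simp: coeff_map_poly coeff_pderiv coeff_pCons split: nat.split)

text \<open>
  Substituting \<open>c t\<close> for \<open>t\<close> in the Gaussian multiplies its parameter by \<open>c\<^sup>2\<close>, and each
  derivative then contributes a factor \<open>c\<close>. Negative \<open>c\<close> is included, so \<open>c = -1\<close> is the parity of
  the Hermite polynomials.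
\<close>
lemma hermite_cpoly_scale:
  "hermite_cpoly (\<mu> * c\<^sup>2) n = smult (of_real c ^ n) (pcompose (hermite_cpoly \<mu> n) [:0, of_real c:])"
proof (induction n)
  case 0
  show ?case by (simp add: hermite_cpoly_0 one_pCons pcompose_pCons)
next
  case (Suc n)
  then show ?case
    by (simp add: hermite_cpoly_Suc pderiv_smult pderiv_pcompose pcompose_diff pcompose_mult
        pcompose_smult pcompose_pCons pderiv_pCons algebra_simps smult_diff_right power2_eq_square)
qed

lemma hermite_complex_scale:
  "hermite_complex (\<mu> * c\<^sup>2) n s = of_real c ^ n * hermite_complex \<mu> n (of_real c * s)"
  by (simp add: hermite_complex_eq_poly hermite_cpoly_scale poly_pcompose mult.commute)

lemma hermite_complex_Suc:
  "hermite_complex \<mu> (Suc n) s =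
    2 * of_real \<mu> * s * hermite_complex \<mu> n s - poly (pderiv (hermite_cpoly \<mu> n)) s"
  by (simp add: hermite_complex_eq_poly hermite_cpoly_Suc)

text \<open>
  The recursion is read backwards here, as a formula for the derivative: the derivative of
  \<open>H\<^sub>n\<close> is then expressed through values of Hermite polynomials alone, which makes the inductions
  below close.
\<close>
lemma has_field_derivative_hermite_complex:
  "(hermite_complex \<mu> n has_field_derivative
     2 * of_real \<mu> * s * hermite_complex \<mu> n s - hermite_complex \<mu> (Suc n) s) (at s)"
  unfolding hermite_complex_Suc by (simp add: hermite_complex_eq_poly poly_DERIV)

text \<open>
  The operator that multiplies by \<open>2 a (s + y)\<close> and subtracts the derivative in \<open>s\<close> takes the left
  side for \<open>n\<close> to the left side for \<open>n + 1\<close>. On the right it splits into multiplication by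
  \<open>2 a y\<close> and the operator raising the index of \<open>H\<^sub>k(s)\<close>, so Pascal's rule applies.
\<close>
lemma hermite_complex_add:
  "hermite_complex a n (s + y) =
    (\<Sum>k\<le>n. of_nat (n choose k) * (hermite_complex a k s * (2 * of_real a * y) ^ (n - k)))"
proof (induction n arbitrary: s)
  case 0
  show ?case by (simp add: hermite_complex_eq_poly hermite_cpoly_0)
next
  case (Suc n)
  let ?H = "hermite_complex a"
  let ?q = "2 * of_real a * y"
  have "((\<lambda>s. ?H n (s + y)) has_field_derivative
      2 * of_real a * (s + y) * ?H n (s + y) - ?H (Suc n) (s + y)) (at s)"
    using DERIV_shift has_field_derivative_hermite_complex by blast
  moreover have "((\<lambda>s. ?H n (s + y)) has_field_derivative
      (\<Sum>k\<le>n. of_nat (n choose k) *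
        ((2 * of_real a * s * ?H k s - ?H (Suc k) s) * ?q ^ (n - k)))) (at s)"
    unfolding Suc.IH
    by (intro DERIV_sum DERIV_cmult DERIV_cmult_right has_field_derivative_hermite_complex)
  \<comment> \<open>The two expressions for the derivative of one function, once from the recursion at \<open>s + y\<close> and
    once term by term from the induction hypothesis, yield the formula for \<open>n + 1\<close>.\<close>
  ultimately have "2 * of_real a * (s + y) * ?H n (s + y) - ?H (Suc n) (s + y) =
      (\<Sum>k\<le>n. of_nat (n choose k) *
        ((2 * of_real a * s * ?H k s - ?H (Suc k) s) * ?q ^ (n - k)))"
    by (rule DERIV_unique)
  then have "?H (Suc n) (s + y) = (2 * of_real a * s + ?q) * ?H n (s + y) -
      (\<Sum>k\<le>n. of_nat (n choose k) *
        ((2 * of_real a * s * ?H k s - ?H (Suc k) s) * ?q ^ (n - k)))"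
    by (simp add: algebra_simps)
  also have "\<dots> = (\<Sum>k\<le>n. of_nat (n choose k) *
      (?H (Suc k) s * ?q ^ (n - k) + ?H k s * ?q ^ Suc (n - k)))"
    unfolding Suc.IH sum_distrib_left sum_subtractf [symmetric]
    by (intro sum.cong refl) (simp add: algebra_simps)
  also have "\<dots> = (\<Sum>k\<le>Suc n. of_nat (Suc n choose k) * (?H k s * ?q ^ (Suc n - k)))"
    by (rule sum_binomial_Suc [symmetric])
  finally show ?case .
qed

section \<open>The generating function\<close>

definition hermite_gen :: "real \<Rightarrow> real \<Rightarrow> real \<Rightarrow> complex \<Rightarrow> complex" where
  "hermite_gen \<mu> x \<xi> w =
    exp (- of_real \<mu> * ((of_real \<xi>)\<^sup>2 * w\<^sup>2 - 2 * of_real x * of_real \<xi> * w))"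

text \<open>
  Completing the square, \<open>hermite_gen \<mu> x \<xi> w\<close> is \<open>exp (\<mu> x\<^sup>2)\<close> times the Gaussian
  \<open>exp (- \<mu> s\<^sup>2)\<close> at \<open>s = x - \<xi> w\<close>. By the recursion, its \<open>k\<close>-th derivative in \<open>s\<close> is
  \<open>(-1)\<^sup>k H\<^sub>k(s)\<close> times the Gaussian; the sign cancels against that of the inner derivative \<open>-\<xi>\<close>.
\<close>
lemma higher_deriv_hermite_gen:
  "(deriv ^^ k) (hermite_gen \<mu> x \<xi>) =
    (\<lambda>w. of_real \<xi> ^ k * hermite_complex \<mu> k (of_real x - of_real \<xi> * w) * hermite_gen \<mu> x \<xi> w)"
proof (induction k)
  case 0
  show ?case by (simp add: hermite_complex_eq_poly hermite_cpoly_0)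
next
  case (Suc k)
  have gen: "(hermite_gen \<mu> x \<xi> has_field_derivative
      2 * of_real \<mu> * of_real \<xi> * (of_real x - of_real \<xi> * w) * hermite_gen \<mu> x \<xi> w) (at w)" for w
    unfolding hermite_gen_def
    by (auto intro!: derivative_eq_intros simp: algebra_simps power2_eq_square)
  have herm: "((\<lambda>w. hermite_complex \<mu> k (of_real x - of_real \<xi> * w)) has_field_derivative
      (2 * of_real \<mu> * (of_real x - of_real \<xi> * w) * hermite_complex \<mu> k (of_real x - of_real \<xi> * w)
        - hermite_complex \<mu> (Suc k) (of_real x - of_real \<xi> * w)) * (- of_real \<xi>)) (at w)" for w
    by (rule DERIV_chain2[OF has_field_derivative_hermite_complex])
      (auto intro!: derivative_eq_intros)
  have "((\<lambda>w. of_real \<xi> ^ k * hermite_complex \<mu> k (of_real x - of_real \<xi> * w) * hermite_gen \<mu> x \<xi> w)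
      has_field_derivative of_real \<xi> ^ Suc k * hermite_complex \<mu> (Suc k) (of_real x - of_real \<xi> * w)
        * hermite_gen \<mu> x \<xi> w) (at w)" for w
    by (rule DERIV_cong[OF DERIV_mult[OF DERIV_cmult[OF herm] gen]]) (simp add: algebra_simps)
  then show ?case
    by (simp only: funpow.simps comp_apply Suc.IH) (intro ext DERIV_imp_deriv)
qed

text \<open>
  This is the Taylor series at \<open>0\<close> of the \<open>k\<close>-th derivative of the generating function, with
  coefficients read off from the preceding lemma at \<open>w = 0\<close>. Expanding each derivative afresh,
  as an entire function, avoids differentiating a power series termwise.
\<close>
lemma hermite_gen_sums:
  "(\<lambda>j. of_real (\<xi> ^ (j + k) * hermite \<mu> (j + k) x) / fact j * w ^ j) sums
    (of_real \<xi> ^ k * hermite_complex \<mu> k (of_real x - of_real \<xi> * w) * hermite_gen \<mu> x \<xi> w)"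
proof -
  let ?G = "(deriv ^^ k) (hermite_gen \<mu> x \<xi>)"
  \<comment> \<open>Any disc around \<open>0\<close> containing \<open>w\<close> serves, as \<open>?G\<close> is entire.\<close>
  have "?G holomorphic_on ball 0 (norm w + 1)"
    unfolding higher_deriv_hermite_gen hermite_complex_eq_poly hermite_gen_def
    by (intro holomorphic_intros)
  then have "(\<lambda>j. (deriv ^^ j) ?G 0 / fact j * (w - 0) ^ j) sums ?G w"
    by (rule holomorphic_power_series) simp
  moreover have "(deriv ^^ j) ?G 0 = of_real (\<xi> ^ (j + k) * hermite \<mu> (j + k) x)" for j
  proof -
    have "(deriv ^^ j) ?G = (deriv ^^ (j + k)) (hermite_gen \<mu> x \<xi>)"
      by (simp add: funpow_add)
    then show ?thesis
      unfolding higher_deriv_hermite_gen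
      by (simp add: hermite_complex_of_real hermite_gen_def)
  qed
  ultimately show ?thesis
    by (simp add: higher_deriv_hermite_gen)
qed

section \<open>Wirtinger calculus and the complex Hermite polynomials\<close>

text \<open>
  A real-linear map of the complex plane has the form \<open>h \<mapsto> A h + B (cnj h)\<close>, and the two
  Wirtinger derivatives are the coefficients \<open>A\<close> and \<open>B\<close> of the total derivative. This lets
  the usual rules for \<open>has_derivative\<close> do all Wirtinger calculus below.
\<close>
lemma wirtinger_eqI:
  assumes "(f has_derivative (\<lambda>h. A * h + B * cnj h)) (at z)"
  shows wirtinger_eq: "wirtinger f z = A" and wirtinger_cnj_eq: "wirtinger_cnj f z = B"
proof -
  \<comment> \<open>The directions \<open>d = 1\<close> and \<open>d = \<i>\<close> are the two partial derivatives.\<close>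
  have line: "vector_derivative (\<lambda>t::real. f (z + d * of_real t)) (at 0) = A * d + B * cnj d" for d
  proof -
    have "((\<lambda>t::real. z + d * of_real t) has_derivative (\<lambda>t. d * of_real t)) (at 0)"
      by (auto intro!: derivative_eq_intros)
    moreover have "(f has_derivative (\<lambda>h. A * h + B * cnj h)) (at (z + d * of_real 0))"
      using assms by simp
    ultimately have "((\<lambda>t::real. f (z + d * of_real t)) has_derivative
        (\<lambda>t. A * (d * of_real t) + B * cnj (d * of_real t))) (at 0)"
      by (rule has_derivative_compose)
    then have "((\<lambda>t::real. f (z + d * of_real t)) has_vector_derivative A * d + B * cnj d) (at 0)"
      by (simp add: has_vector_derivative_def scaleR_conv_of_real algebra_simps)
    then show ?thesis by (rule vector_derivative_at)
  qed
  have "partial_Re f z = A + B" and "partial_Im f z = \<i> * (A - B)"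
    using line[of 1] line[of \<i>] by (simp_all add: partial_Re_def partial_Im_def algebra_simps)
  then show "wirtinger f z = A" and "wirtinger_cnj f z = B"
    by (simp_all add: wirtinger_def wirtinger_cnj_def flip: mult.assoc)
qed

lemma has_derivative_gaussian:
  "((\<lambda>w. exp (- of_real \<nu> * w * cnj w)) has_derivative
    (\<lambda>h. (- of_real \<nu> * cnj w * exp (- of_real \<nu> * w * cnj w)) * h
       + (- of_real \<nu> * w * exp (- of_real \<nu> * w * cnj w)) * cnj h)) (at w)"
proof -
  have "((\<lambda>w. - of_real \<nu> * w * cnj w) has_derivative
      (\<lambda>h. - of_real \<nu> * cnj w * h - of_real \<nu> * w * cnj h)) (at w)"
    by (auto intro!: derivative_eq_intros simp: algebra_simps)
  from has_derivative_compose[OF this DERIV_exp[unfolded has_field_derivative_def]]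
  show ?thesis by (simp add: algebra_simps)
qed

lemma has_derivative_poly_cnj:
  "((\<lambda>w. poly p (cnj w)) has_derivative (\<lambda>h. poly (pderiv p) (cnj w) * cnj h)) (at w)"
  using has_derivative_compose[OF has_derivative_cnj[OF has_derivative_ident]
      poly_DERIV[unfolded has_field_derivative_def]] .

lemma wirtinger_gaussian:
  "(wirtinger ^^ n) (\<lambda>w. exp (- of_real \<nu> * w * cnj w)) =
    (\<lambda>w. poly (monom ((- of_real \<nu>) ^ n) n) (cnj w) * exp (- of_real \<nu> * w * cnj w))"
proof (induction n)
  case 0
  show ?case by (simp add: monom_0)
next
  case (Suc n)
  let ?E = "\<lambda>w. exp (- of_real \<nu> * w * cnj w)"
  let ?p = "monom ((- of_real \<nu>) ^ n :: complex) n"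
  have "((\<lambda>w. poly ?p (cnj w) * ?E w) has_derivative
      (\<lambda>h. (poly ?p (cnj w) * (- of_real \<nu> * cnj w * ?E w)) * h
         + (poly ?p (cnj w) * (- of_real \<nu> * w * ?E w) + poly (pderiv ?p) (cnj w) * ?E w) * cnj h))
      (at w)" for w
    by (rule has_derivative_eq_rhs[OF has_derivative_mult[OF has_derivative_poly_cnj
          has_derivative_gaussian]]) (simp add: fun_eq_iff algebra_simps)
  from wirtinger_eq[OF this] show ?case
    unfolding funpow.simps comp_apply Suc.IH by (simp add: fun_eq_iff poly_monom algebra_simps)
qed

text \<open>
  The Leibniz rule in the variable \<open>cnj w\<close>: a derivative in \<open>cnj w\<close> falls either on the polynomial
  or on the Gaussian, where it produces the factor \<open>- \<nu> w\<close>, which is constant for this derivative.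
\<close>
lemma wirtinger_cnj_poly_gaussian:
  "(wirtinger_cnj ^^ m) (\<lambda>w. poly p (cnj w) * exp (- of_real \<nu> * w * cnj w)) =
    (\<lambda>w. (\<Sum>k\<le>m. of_nat (m choose k) *
      (poly ((pderiv ^^ k) p) (cnj w) * (- of_real \<nu> * w) ^ (m - k))) * exp (- of_real \<nu> * w * cnj w))"
proof (induction m)
  case 0
  show ?case by simp
next
  case (Suc m)
  let ?E = "\<lambda>w. exp (- of_real \<nu> * w * cnj w)"
  let ?d = "\<lambda>k. poly ((pderiv ^^ k) p)"
  let ?q = "\<lambda>w. - of_real \<nu> * w"
  let ?S = "\<lambda>w. \<Sum>k\<le>m. of_nat (m choose k) * (?d k (cnj w) * ?q w ^ (m - k))"
  show ?case
  proof
    fix w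
    \<comment> \<open>The coefficients of \<open>h\<close> and of \<open>cnj h\<close> in the derivative of the \<open>k\<close>-th summand.\<close>
    define A where "A k = of_nat (m choose k) *
      (?d k (cnj w) * (of_nat (m - k) * (- of_real \<nu>) * ?q w ^ (m - k - 1)))" for k
    define B where "B k = of_nat (m choose k) * (?d (Suc k) (cnj w) * ?q w ^ (m - k))" for k
    have pow: "((\<lambda>w. ?q w ^ (m - k)) has_derivative
        (\<lambda>h. (of_nat (m - k) * (- of_real \<nu>) * ?q w ^ (m - k - 1)) * h)) (at w)" for k
      by (rule has_derivative_eq_rhs[OF has_derivative_power[OF has_derivative_mult_right[OF
            has_derivative_ident]]]) (simp add: fun_eq_iff algebra_simps)
    have "((\<lambda>w. of_nat (m choose k) * (?d k (cnj w) * ?q w ^ (m - k))) has_derivative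
        (\<lambda>h. A k * h + B k * cnj h)) (at w)" for k
      by (rule has_derivative_eq_rhs[OF has_derivative_mult_right[OF has_derivative_mult[OF
            has_derivative_poly_cnj pow]]]) (simp add: fun_eq_iff A_def B_def algebra_simps)
    then have "(?S has_derivative (\<lambda>h. (\<Sum>k\<le>m. A k * h + B k * cnj h))) (at w)"
      by (intro has_derivative_sum)
    then have "(?S has_derivative (\<lambda>h. (\<Sum>k\<le>m. A k) * h + (\<Sum>k\<le>m. B k) * cnj h)) (at w)"
      by (simp add: sum.distrib sum_distrib_right)
    from has_derivative_mult[OF this has_derivative_gaussian[of \<nu>]]
    have "((\<lambda>w. ?S w * ?E w) has_derivative
        (\<lambda>h. ((\<Sum>k\<le>m. A k) * ?E w + ?S w * (- of_real \<nu> * cnj w * ?E w)) * h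
          + ((\<Sum>k\<le>m. B k) + ?S w * ?q w) * ?E w * cnj h)) (at w)"
      by (rule has_derivative_eq_rhs)
        (simp add: fun_eq_iff algebra_simps)
    then have "wirtinger_cnj (\<lambda>w. ?S w * ?E w) w = ((\<Sum>k\<le>m. B k) + ?S w * ?q w) * ?E w"
      by (rule wirtinger_cnj_eq)
    also have "(\<Sum>k\<le>m. B k) + ?S w * ?q w = (\<Sum>k\<le>m. of_nat (m choose k) *
        (?d (Suc k) (cnj w) * ?q w ^ (m - k) + ?d k (cnj w) * ?q w ^ Suc (m - k)))"
      unfolding sum_distrib_right sum.distrib[symmetric] B_def
      by (intro sum.cong refl) (simp add: algebra_simps)
    also have "\<dots> = (\<Sum>k\<le>Suc m. of_nat (Suc m choose k) * (?d k (cnj w) * ?q w ^ (Suc m - k)))"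
      by (rule sum_binomial_Suc[symmetric])
    finally show "(wirtinger_cnj ^^ Suc m) (\<lambda>w. poly p (cnj w) * ?E w) w =
        (\<Sum>k\<le>Suc m. of_nat (Suc m choose k) * (?d k (cnj w) * ?q w ^ (Suc m - k))) * ?E w"
      by (simp only: funpow.simps comp_apply Suc.IH)
  qed
qed

lemma higher_pderiv_monom_eq:
  "(pderiv ^^ k) (monom (c::'a::idom) n) = monom (of_nat ((n choose k) * fact k) * c) (n - k)"
proof (induction k)
  case 0
  show ?case by simp
next
  case (Suc k)
  have "(n choose Suc k) * fact (Suc k) = (n - k) * ((n choose k) * fact k)"
    by (metis binomial_absorb_comp binomial_absorption fact_Suc mult.assoc mult.commute of_nat_id)
  with Suc show ?case by (simp add: pderiv_monom mult.assoc del: fact_Suc)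
qed

text \<open>
  Leibniz's rule yields a sum over \<open>k \<le> m\<close>, while the sum here runs over \<open>k \<le> n\<close>: the summand
  vanishes as soon as \<open>k\<close> exceeds \<open>m\<close> or \<open>n\<close>. A range independent of \<open>m\<close> is what allows
  the series over \<open>m\<close> to be summed for each \<open>k\<close> separately.
\<close>
lemma hermite2_explicit:
  "hermite2 \<nu> m n z = (\<Sum>k\<le>n. (-1) ^ k * of_nat ((n choose k) * (m choose k) * fact k) *
    of_real \<nu> ^ (n + (m - k)) * cnj z ^ (n - k) * z ^ (m - k))"
proof -
  let ?t = "\<lambda>k. (-1) ^ k * of_nat ((n choose k) * (m choose k) * fact k) *
    of_real \<nu> ^ (n + (m - k)) * cnj z ^ (n - k) * z ^ (m - k)"
  have "hermite2 \<nu> m n z = (-1) ^ (m + n) * (\<Sum>k\<le>m. of_nat (m choose k) *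
      (poly (monom (of_nat ((n choose k) * fact k) * (- of_real \<nu>) ^ n) (n - k)) (cnj z)
        * (- of_real \<nu> * z) ^ (m - k)))"
    unfolding hermite2_def wirtinger_gaussian wirtinger_cnj_poly_gaussian higher_pderiv_monom_eq
    by (simp add: exp_minus)
  \<comment> \<open>Of the \<open>m + n\<close> signs in front, \<open>n\<close> cancel against the derivatives in \<open>z\<close> and \<open>m - k\<close> against
    the factors \<open>- \<nu> z\<close>, leaving \<open>(-1)\<^sup>k\<close>.\<close>
  also have "\<dots> = (\<Sum>k\<le>m. ?t k)"
    unfolding sum_distrib_left
  proof (intro sum.cong refl)
    fix k assume "k \<in> {..m}"
    then obtain j where m: "m = k + j" by (auto simp: le_iff_add)
    have sq: "(-1::complex) ^ i * (-1) ^ i = 1" for i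
      by (simp flip: power_mult_distrib)
    have neg: "(- a) ^ i = (-1) ^ i * a ^ i" for a :: complex and i
      by (rule power_minus)
    have q: "(- of_real \<nu> * z) ^ (m - k) = (-1) ^ j * (of_real \<nu> ^ j * z ^ j)"
      using neg[of "of_real \<nu> * z" j] by (simp add: m power_mult_distrib)
    have "(-1) ^ (m + n) * ((- of_real \<nu>) ^ n * (- of_real \<nu> * z) ^ (m - k)) =
        ((-1) ^ n * (-1) ^ n) * ((-1) ^ j * (-1) ^ j) * (-1) ^ k *
          (of_real \<nu> ^ (n + (m - k)) * z ^ (m - k))"
      unfolding neg[of "of_real \<nu>" n] q by (simp only: m power_add add_diff_cancel_left' mult_ac)
    then have sign: "(-1) ^ (m + n) * ((- of_real \<nu>) ^ n * (- of_real \<nu> * z) ^ (m - k)) =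
        (-1) ^ k * (of_real \<nu> ^ (n + (m - k)) * z ^ (m - k))"
      by (simp only: sq mult_1)
    have "(-1) ^ (m + n) * (of_nat (m choose k) *
        (poly (monom (of_nat ((n choose k) * fact k) * (- of_real \<nu>) ^ n) (n - k)) (cnj z)
          * (- of_real \<nu> * z) ^ (m - k))) =
        of_nat ((n choose k) * (m choose k) * fact k) * cnj z ^ (n - k) *
        ((-1) ^ (m + n) * ((- of_real \<nu>) ^ n * (- of_real \<nu> * z) ^ (m - k)))"
      by (simp only: poly_monom of_nat_mult mult_ac)
    also have "\<dots> = ?t k"
      unfolding sign by (simp only: mult_ac)
    finally show "(-1) ^ (m + n) * (of_nat (m choose k) *
        (poly (monom (of_nat ((n choose k) * fact k) * (- of_real \<nu>) ^ n) (n - k)) (cnj z)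
          * (- of_real \<nu> * z) ^ (m - k))) = ?t k" .
  qed
  also have "\<dots> = (\<Sum>k\<le>max m n. ?t k)"
    by (rule sum.mono_neutral_left) (auto simp: binomial_eq_0)
  also have "\<dots> = (\<Sum>k\<le>n. ?t k)"
    by (rule sum.mono_neutral_right) (auto simp: binomial_eq_0)
  finally show ?thesis .
qed

section \<open>Summation\<close>

text \<open>
  The Taylor series of \<open>hermite_gen_sums\<close>, reindexed by \<open>m = j + k\<close>. The factor \<open>(m choose k) * fact k\<close> is the
  falling factorial; it vanishes for \<open>m < k\<close>, so that the truncated exponent \<open>m - k\<close> does no harm.
\<close>
lemma hermite_shifted_sums:
  "(\<lambda>m. of_real (\<xi> ^ m * hermite \<mu> m x) * (of_nat ((m choose k) * fact k) / fact m) * w ^ (m - k)) sums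
    (of_real \<xi> ^ k * hermite_complex \<mu> k (of_real x - of_real \<xi> * w) * hermite_gen \<mu> x \<xi> w)"
  (is "?f sums ?s")
proof -
  have "?f (j + k) = of_real (\<xi> ^ (j + k) * hermite \<mu> (j + k) x) / fact j * w ^ j" for j
  proof -
    have "(fact (j + k) :: complex) = of_nat ((j + k choose k) * fact k) * fact j"
      using arg_cong[OF binomial_fact_lemma[of k "j + k"], of "of_nat :: nat \<Rightarrow> complex"]
      by (simp add: mult_ac)
    moreover have "(of_nat ((j + k choose k) * fact k) :: complex) \<noteq> 0"
      by simp
    ultimately show ?thesis by (simp add: divide_simps)
  qed
  then have "(\<lambda>j. ?f (j + k)) sums ?s"
    using hermite_gen_sums[of \<xi> k \<mu> x w] by simp
  moreover have "?f i = 0" if "i < k" for i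
    using that by (simp add: binomial_eq_0)
  ultimately show ?thesis
    using sums_zero_iff_shift[of k ?f ?s] by simp
qed

theorem theorem4p2:
  fixes \<mu> \<nu> x \<xi> :: real and n :: nat and z :: complex
  assumes "\<mu> > 0" and "\<nu> > 0" and "\<xi> \<noteq> 0"
  shows "(\<lambda>m. of_real (\<xi> ^ m * hermite \<mu> m x) * cnj (hermite2 \<nu> m n z) / (fact m * of_real (\<nu> ^ m)))
    sums (exp (- of_real \<mu> * ((of_real \<xi>)\<^sup>2 * (cnj z)\<^sup>2 - 2 * of_real x * of_real \<xi> * cnj z)) *
      hermite_complex (\<mu> * \<xi>\<^sup>2) n
        (cnj z + of_real (\<nu> / (2 * \<mu> * \<xi>\<^sup>2)) * z - of_real (x / \<xi>)))"
proof -
  let ?a = "\<mu> * \<xi>\<^sup>2"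
  let ?w = "cnj z"
  let ?y = "of_real (\<nu> / (2 * ?a)) * z"
  let ?s = "?w - of_real (x / \<xi>)"
  let ?G = "hermite_gen \<mu> x \<xi> ?w"
  \<comment> \<open>The general term of the series splits into \<open>c k * f k m\<close> summed over \<open>k \<le> n\<close>, with \<open>H k\<close> the
    sum of \<open>f k\<close>, that is, the \<open>k\<close>-th derivative of the generating function at \<open>cnj z\<close>.\<close>
  define c where "c k = (-1) ^ k * of_nat (n choose k) * (of_real \<nu> * z) ^ (n - k)" for k
  define f where "f k m = of_real (\<xi> ^ m * hermite \<mu> m x) *
    (of_nat ((m choose k) * fact k) / fact m) * ?w ^ (m - k)" for k m
  define H where "H k = of_real \<xi> ^ k * hermite_complex \<mu> k (of_real x - of_real \<xi> * ?w) * ?G" for k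
  have "(\<lambda>m. \<Sum>k\<le>n. c k * f k m) sums (\<Sum>k\<le>n. c k * H k)"
    unfolding f_def H_def by (intro sums_sum sums_mult hermite_shifted_sums)
  moreover have "(\<Sum>k\<le>n. c k * f k m) =
      of_real (\<xi> ^ m * hermite \<mu> m x) * cnj (hermite2 \<nu> m n z) / (fact m * of_real (\<nu> ^ m))" for m
  proof -
    have "c k * f k m = of_real (\<xi> ^ m * hermite \<mu> m x) *
        cnj ((-1) ^ k * of_nat ((n choose k) * (m choose k) * fact k) *
          of_real \<nu> ^ (n + (m - k)) * cnj z ^ (n - k) * z ^ (m - k)) / (fact m * of_real (\<nu> ^ m))"
      if "k \<le> n" for k
    proof (cases "k \<le> m")
      case True
      with \<open>k \<le> n\<close> have "n + (m - k) = (n - k) + m" by simp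
      then have "(of_real \<nu> :: complex) ^ (n + (m - k)) = of_real \<nu> ^ (n - k) * of_real \<nu> ^ m"
        by (simp only: power_add)
      with \<open>\<nu> > 0\<close> show ?thesis
        by (simp add: c_def f_def power_mult_distrib)
    next
      case False
      then show ?thesis by (simp add: f_def binomial_eq_0)
    qed
    then show ?thesis
      by (simp add: hermite2_explicit sum_distrib_left sum_divide_distrib)
  qed
  moreover have "(\<Sum>k\<le>n. c k * H k) = ?G * hermite_complex ?a n (?s + ?y)"
  proof -
    have arg: "of_real (- \<xi>) * ?s = of_real x - of_real \<xi> * ?w"
      using \<open>\<xi> \<noteq> 0\<close> by (simp add: algebra_simps)
    \<comment> \<open>The sign \<open>(-1)\<^sup>k\<close> of \<open>c k\<close> makes the scaling factor \<open>-\<xi>\<close>.\<close>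
    have H: "(-1) ^ k * H k = ?G * hermite_complex ?a k ?s" for k
      using hermite_complex_scale[of \<mu> "- \<xi>" k ?s]
      unfolding arg by (simp add: H_def power_minus[of "of_real \<xi>"] mult_ac)
    have y: "2 * of_real ?a * ?y = of_real \<nu> * z"
      using \<open>\<mu> > 0\<close> \<open>\<xi> \<noteq> 0\<close> by (simp add: field_simps)
    have "c k * H k = ?G * (of_nat (n choose k) *
        (hermite_complex ?a k ?s * (2 * of_real ?a * ?y) ^ (n - k)))" for k
    proof -
      have "c k * H k = of_nat (n choose k) * (of_real \<nu> * z) ^ (n - k) * ((-1) ^ k * H k)"
        by (simp add: c_def mult_ac)
      then show ?thesis unfolding y H by (simp only: mult_ac)
    qed
    then show ?thesis
      by (simp only: hermite_complex_add sum_distrib_left)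
  qed
  moreover have "?s + ?y = ?w + of_real (\<nu> / (2 * \<mu> * \<xi>\<^sup>2)) * z - of_real (x / \<xi>)"
    by (simp add: mult.assoc)
  ultimately show ?thesis
    by (simp only: hermite_gen_def)
qed

end
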